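(* Let $p\in\Delta_q$ be a fixed reference probability and $\theta\in[0,1]$. Let $x^0\in\mathrm{Range}(\mathbf{B}^{-1}\mathbf{A}^\top)$ and let $(x^k)_{k\ge0}$ be generated by capped adaptive sketch-and-project: for every $k\ge0$, set $$\mathcal{W}_k=\Bigl\{i\ :\ f_i(x^k)\ge\theta\max_{j=1,\dots,q}f_j(x^k)+(1-\theta)\,\mathbb{E}_{j\sim p}[f_j(x^k)]\Bigr\},$$ choose any $p^k\in\Delta_q$ whose support is contained in $\mathcal{W}_k$, draw $i_k$ with $\mathbb{P}[i_k=i\mid x^k]=p_i^k$, and set $x^{k+1}=x^k-\mathbf{B}^{-1}\mathbf{A}^\top\mathbf{H}_{i_k}(\mathbf{A}x^k-b)$. Then for all $k\ge0$ $$\mathbb{E}\bigl[\|x^{k}-x^*\|_{\mathbf{B}}^2\bigr]\le\bigl(1-\theta\,\sigma_\infty^2(\mathbf{B},\mathbf{S})-(1-\theta)\,\sigma_p^2(\mathbf{B},\mathbf{S})\bigr)^k\,\|x^{0}-x^*\|_{\mathbf{B}}^2 .$$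
   Context: Setting: $\mathbf{A}\in\mathbb{R}^{m\times n}$ is a nonzero matrix and $b\in\mathbb{R}^m$ is such that $\mathbf{A}x=b$ is consistent. $\mathbf{B}\in\mathbb{R}^{n\times n}$ is symmetric positive definite. For positive semidefinite $\mathbf{G}$, $\|v\|_{\mathbf{G}}^2=\langle v,\mathbf{G}v\rangle$. $x^*$ is the solution of $\mathbf{A}x=b$ minimizing $\frac12\|x\|_{\mathbf{B}}^2$. $\mathbf{S}_1,\dots,\mathbf{S}_q\in\mathbb{R}^{m\times\tau}$ is a finite family of sketching matrices, collectively denoted $\mathbf{S}$. With $\dagger$ the Moore–Penrose pseudoinverse, $$\mathbf{H}_i=\mathbf{S}_i(\mathbf{S}_i^\top\mathbf{A}\mathbf{B}^{-1}\mathbf{A}^\top\mathbf{S}_i)^\dagger\mathbf{S}_i^\top,\qquad \mathbf{Z}_i=\mathbf{B}^{-1/2}\mathbf{A}^\top\mathbf{H}_i\mathbf{A}\mathbf{B}^{-1/2},\qquad f_i(x)=\|\mathbf{A}x-b\|_{\mathbf{H}_i}^2 .$$ $\Delta_q=\{p\in\mathbb{R}^q:\sum_i p_i=1,\ p_i\ge0\}$ and $\mathbb{E}_{i\sim p}[y_i]=\sum_{i=1}^q p_iy_i$ for any scalars or matrices $y_i$. The spectral constants are $$\sigma_\infty^2(\mathbf{B},\mathbf{S})=\min_{0\ne v\in\mathrm{Range}(\mathbf{B}^{-1}\mathbf{A}^\top)}\max_{i=1,\dots,q}\frac{\|\mathbf{B}^{1/2}v\|_{\mathbf{Z}_i}^2}{\|v\|_{\mathbf{B}}^2},\qquad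 \sigma_p^2(\mathbf{B},\mathbf{S})=\min_{0\ne v\in\mathrm{Range}(\mathbf{B}^{-1}\mathbf{A}^\top)}\frac{\|\mathbf{B}^{1/2}v\|_{\mathbb{E}_{i\sim p}[\mathbf{Z}_i]}^2}{\|v\|_{\mathbf{B}}^2}.$$ The vector $p^k$ is determined by $x^k$, and $\mathbb{E}$ denotes expectation over the random indices. *)

theory Defs
  imports "HOL-Probability.Probability"
begin

definition pos_semidef :: "real^'n^'n \<Rightarrow> bool" where
  "pos_semidef G \<longleftrightarrow> transpose G = G \<and> (\<forall>v. 0 \<le> v \<bullet> (G *v v))"

definition pos_def :: "real^'n^'n \<Rightarrow> bool" where
  "pos_def G \<longleftrightarrow> transpose G = G \<and> (\<forall>v. v \<noteq> 0 \<longrightarrow> 0 < v \<bullet> (G *v v))"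

text \<open>The squared (semi)norm \<open>\<parallel>v\<parallel>\<^sub>G\<^sup>2\<close>, meant for positive semidefinite \<open>G\<close>.\<close>

definition mnorm_sq :: "real^'n^'n \<Rightarrow> real^'n \<Rightarrow> real" where
  "mnorm_sq G v = v \<bullet> (G *v v)"

text \<open>A positive semidefinite matrix has exactly one positive semidefinite square root.\<close>

definition msqrt :: "real^'n^'n \<Rightarrow> real^'n^'n" where
  "msqrt G = (THE R. pos_semidef R \<and> R ** R = G)"

text \<open>The Moore-Penrose pseudoinverse: every real matrix has exactly one matrix satisfying the
  four Penrose equations.\<close>

definition is_pinv :: "real^'n^'m \<Rightarrow> real^'m^'n \<Rightarrow> bool" where
  "is_pinv M X \<longleftrightarrow> M ** X ** M = M \<and> X ** M ** X = X \<and>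
     transpose (M ** X) = M ** X \<and> transpose (X ** M) = X ** M"

definition pinv :: "real^'n^'m \<Rightarrow> real^'m^'n" where
  "pinv M = (THE X. is_pinv M X)"

definition prob_simplex :: "(real^'q) set" where
  "prob_simplex = {p. (\<Sum>i\<in>UNIV. p $ i) = 1 \<and> (\<forall>i. 0 \<le> p $ i)}"

text \<open>The finite expectation \<open>E\<close> over \<open>i \<sim> p\<close> of \<open>y i\<close>; the values may be scalars or matrices.\<close>

definition mean :: "real^'q \<Rightarrow> ('q \<Rightarrow> 'a::real_vector) \<Rightarrow> 'a" where
  "mean p y = (\<Sum>i\<in>UNIV. p $ i *\<^sub>R y i)"

definition min_norm_solution :: "real^'n^'m \<Rightarrow> real^'m \<Rightarrow> real^'n^'n \<Rightarrow> real^'n" where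
  "min_norm_solution A b B = (ARG_MIN (\<lambda>x. 1 / 2 * mnorm_sq B x) x. A *v x = b)"

definition sketch_H ::
    "real^'n^'m \<Rightarrow> real^'n^'n \<Rightarrow> ('q \<Rightarrow> real^'t^'m) \<Rightarrow> 'q \<Rightarrow> real^'m^'m" where
  "sketch_H A B S i =
     S i ** pinv (transpose (S i) ** A ** matrix_inv B ** transpose A ** S i) ** transpose (S i)"

definition sketch_Z ::
    "real^'n^'m \<Rightarrow> real^'n^'n \<Rightarrow> ('q \<Rightarrow> real^'t^'m) \<Rightarrow> 'q \<Rightarrow> real^'n^'n" where
  "sketch_Z A B S i =
     matrix_inv (msqrt B) ** transpose A ** sketch_H A B S i ** A ** matrix_inv (msqrt B)"

definition sketch_loss ::
    "real^'n^'m \<Rightarrow> real^'m \<Rightarrow> real^'n^'n \<Rightarrow> ('q \<Rightarrow> real^'t^'m) \<Rightarrow> 'q \<Rightarrow> real^'n \<Rightarrow> real" where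
  "sketch_loss A b B S i x = mnorm_sq (sketch_H A B S i) (A *v x - b)"

definition sketch_step ::
    "real^'n^'m \<Rightarrow> real^'m \<Rightarrow> real^'n^'n \<Rightarrow> ('q \<Rightarrow> real^'t^'m) \<Rightarrow> 'q \<Rightarrow> real^'n \<Rightarrow> real^'n" where
  "sketch_step A b B S i x =
     x - (matrix_inv B ** transpose A ** sketch_H A B S i) *v (A *v x - b)"

definition mrange :: "real^'n^'m \<Rightarrow> (real^'m) set" where
  "mrange M = range ((*v) M)"

text \<open>The two spectral constants are minima over infinite sets, written with \<open>LEAST\<close>. For
  \<open>A \<noteq> 0\<close> and positive definite \<open>B\<close> both minima are attained: the quotients are continuous and
  invariant under scaling of \<open>v\<close>, and the subspace is nonzero and finite-dimensional.\<close>

definition sigma_max_sq ::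
    "real^'n^'m \<Rightarrow> real^'n^'n \<Rightarrow> ('q::finite \<Rightarrow> real^'t^'m) \<Rightarrow> real" where
  "sigma_max_sq A B S =
     (LEAST s. s \<in> {(MAX i. mnorm_sq (sketch_Z A B S i) (msqrt B *v v) / mnorm_sq B v) | v.
                      v \<in> mrange (matrix_inv B ** transpose A) \<and> v \<noteq> 0})"

definition sigma_mean_sq ::
    "real^'n^'m \<Rightarrow> real^'n^'n \<Rightarrow> ('q::finite \<Rightarrow> real^'t^'m) \<Rightarrow> real^'q \<Rightarrow> real" where
  "sigma_mean_sq A B S p =
     (LEAST s. s \<in> {mnorm_sq (mean p (sketch_Z A B S)) (msqrt B *v v) / mnorm_sq B v | v.
                      v \<in> mrange (matrix_inv B ** transpose A) \<and> v \<noteq> 0})"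

definition capped_set ::
    "real^'n^'m \<Rightarrow> real^'m \<Rightarrow> real^'n^'n \<Rightarrow> ('q::finite \<Rightarrow> real^'t^'m) \<Rightarrow> real^'q \<Rightarrow> real \<Rightarrow>
     real^'n \<Rightarrow> 'q set" where
  "capped_set A b B S p \<theta> x =
     {i. sketch_loss A b B S i x
           \<ge> \<theta> * (MAX j. sketch_loss A b B S j x)
             + (1 - \<theta>) * mean p (\<lambda>j. sketch_loss A b B S j x)}"

end

theory Submission
  imports Defs
begin

text \<open>A sketch-and-project step is the \<open>B\<close>-orthogonal projection of the iterate onto the solution set of
  the sketched system. Hence Pythagoras gives, for every solution \<open>x*\<close> of the full system,
  \<open>\<parallel>x' - x*\<parallel>\<^sub>B\<^sup>2 = \<parallel>x - x*\<parallel>\<^sub>B\<^sup>2 - f\<^sub>i(x)\<close>: choosing the sketch \<open>i\<close> lowers the squared error by exactly the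
  loss \<open>f\<^sub>i(x)\<close> (lemma \<open>mnorm_sq_sketch_step\<close>). Algebraically this rests on \<open>H\<^sub>i W H\<^sub>i = H\<^sub>i\<close> for the
  Gram matrix \<open>W = A B\<^sup>-\<^sup>1 A\<^sup>T\<close>, which is the Penrose equation \<open>X M X = X\<close> in disguise.

  Both the starting point and the least-norm solution lie in \<open>Range(B\<^sup>-\<^sup>1 A\<^sup>T)\<close>, and steps stay there, so
  all errors lie in the subspace over which the spectral constants are minimised. There
  \<open>f\<^sub>i(x)\<close> is the numerator of the quotients defining them, and so \<open>max f\<^sub>i \<ge> \<sigma>\<^sub>\<infinity>\<^sup>2 \<parallel>e\<parallel>\<^sub>B\<^sup>2\<close> and
  \<open>E\<^sub>p f\<^sub>i \<ge> \<sigma>\<^sub>p\<^sup>2 \<parallel>e\<parallel>\<^sub>B\<^sup>2\<close>. Every index that is drawn with positive probability belongs to the capped set, so its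
  loss is at least the \<open>\<theta>\<close>-mixture of these two quantities (lemma \<open>capped_mean_loss_ge\<close>). Taking
  the expectation conditionally on the current iterate gives contraction by the factor
  \<open>1 - \<theta> \<sigma>\<^sub>\<infinity>\<^sup>2 - (1 - \<theta>) \<sigma>\<^sub>p\<^sup>2\<close>. This factor is nonnegative, because \<open>f\<^sub>i(x) \<le> \<parallel>e\<parallel>\<^sub>B\<^sup>2\<close> makes both constants
  at most \<open>1\<close>; so the bound can be iterated.

  The matrix square root, the pseudoinverse, the least-norm solution and the two minima are introduced by
  description operators, which say nothing until existence is established. The square root
  and the pseudoinverse come from the spectral theorem for real symmetric matrices: prescribe
  eigenvalues \<open>\<surd>\<mu>\<close>, respectively \<open>1/\<mu>\<close>, on an orthonormal eigenbasis. The least-norm solution is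
  \<open>B\<^sup>-\<^sup>1 A\<^sup>T W\<^sup>\<dagger> b\<close>, and the minima are attained by compactness of the unit sphere.\<close>

section \<open>The spectral theorem for real symmetric matrices\<close>

lemma inner_matrix_vector:
  fixes A :: "real^'n^'m"
  shows "x \<bullet> (A *v y) = (transpose A *v x) \<bullet> y"
  by (simp add: dot_lmul_matrix)

lemma inner_symmetric_matrix:
  fixes G :: "real^'n^'n"
  assumes "transpose G = G"
  shows "x \<bullet> (G *v y) = (G *v x) \<bullet> y"
  using assms inner_matrix_vector[of x G y] by simp

text \<open>The first-order condition at a minimum: a quadratic in \<open>t\<close> that vanishes at \<open>0\<close> and is nonnegative
  everywhere has no linear part, since otherwise a small step of the right sign makes it negative.\<close>

lemma linear_coefficient_zero:
  fixes a c :: real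
  assumes "\<And>t. 0 \<le> 2 * t * a + t\<^sup>2 * c"
  shows "a = 0"
proof (rule ccontr)
  assume a: "a \<noteq> 0"
  define d where "d = \<bar>c\<bar> + 1"
  have d: "d > 0" "c \<le> d" by (auto simp: d_def)
  \<comment> \<open>With \<open>c\<close> replaced by the larger positive \<open>d\<close>, the quadratic has its minimum at \<open>- a / d\<close>.\<close>
  have "0 \<le> 2 * (- a / d) * a + (- a / d)\<^sup>2 * c" by (rule assms)
  also have "\<dots> \<le> 2 * (- a / d) * a + (- a / d)\<^sup>2 * d"
    using d by (intro add_left_mono mult_left_mono) auto
  also have "\<dots> = - (a\<^sup>2 / d)" using d by (simp add: field_simps power2_eq_square)
  also have "\<dots> < 0" using a d by simp
  finally show False by simp
qed

text \<open>A maximiser \<open>u\<close> of the Rayleigh quotient over the unit sphere of an invariant subspace is an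
  eigenvector: moving away from \<open>u\<close> in the direction of the residual \<open>\<mu> u - G u\<close> changes the form
  \<open>\<mu> \<langle>v, v\<rangle> - \<langle>v, G v\<rangle>\<close>, which is nonnegative on the subspace and zero at \<open>u\<close>, to first order by twice the
  squared length of that residual.\<close>

lemma symmetric_has_eigenvector_in_subspace:
  fixes G :: "real^'n^'n"
  assumes sym: "transpose G = G" and V: "subspace V" "V \<noteq> {0}"
    and inv: "\<And>v. v \<in> V \<Longrightarrow> G *v v \<in> V"
  obtains u \<mu> where "u \<in> V" "norm u = 1" "G *v u = \<mu> *\<^sub>R u"
proof -
  obtain v0 where v0: "v0 \<in> V" "v0 \<noteq> 0" using V subspace_0 by blast
  have "compact (V \<inter> sphere 0 1)"
    using V by (intro closed_Int_compact closed_subspace compact_sphere)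
  moreover have "v0 /\<^sub>R norm v0 \<in> V \<inter> sphere 0 1"
    using v0 V by (auto simp: subspace_scale)
  moreover have "continuous_on (V \<inter> sphere 0 1) (\<lambda>v. v \<bullet> (G *v v))"
    by (intro continuous_intros linear_continuous_on linear_conv_bounded_linear[THEN iffD1]) auto
  ultimately obtain u where "u \<in> V \<inter> sphere 0 1"
    and "\<forall>v\<in>V \<inter> sphere 0 1. v \<bullet> (G *v v) \<le> u \<bullet> (G *v u)"
    using continuous_attains_sup[of "V \<inter> sphere 0 1" "\<lambda>v. v \<bullet> (G *v v)"] by blast
  then have u: "u \<in> V" "norm u = 1"
    and max: "\<And>v. v \<in> V \<Longrightarrow> norm v = 1 \<Longrightarrow> v \<bullet> (G *v v) \<le> u \<bullet> (G *v u)"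
    by simp_all
  define \<mu> where "\<mu> = u \<bullet> (G *v u)"
  define h where "h = (\<lambda>v. \<mu> * (v \<bullet> v) - v \<bullet> (G *v v))"
  have h_nonneg: "0 \<le> h v" if "v \<in> V" for v
  proof (cases "v = 0")
    case False
    have "(v /\<^sub>R norm v) \<bullet> (G *v (v /\<^sub>R norm v)) \<le> \<mu>"
      unfolding \<mu>_def using that V False by (intro max) (auto simp: subspace_scale)
    then show ?thesis
      using False by (simp add: h_def matrix_vector_mult_scaleR field_simps power2_norm_eq_inner[symmetric] power2_eq_square)
  qed (simp add: h_def)
  define w where "w = \<mu> *\<^sub>R u - G *v u"
  have wV: "w \<in> V"
    unfolding w_def using u V inv by (auto intro: subspace_diff subspace_scale)
  have "0 \<le> 2 * t * (w \<bullet> w) + t\<^sup>2 * h w" for t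
  proof -
    have uu: "u \<bullet> u = 1" using u by (simp add: norm_eq_1)
    have "0 \<le> h (u + t *\<^sub>R w)" using u wV V by (intro h_nonneg) (auto intro: subspace_add subspace_scale)
    also have "h (u + t *\<^sub>R w) = 2 * t * (w \<bullet> w) + t\<^sup>2 * h w"
    proof -
      have s: "u \<bullet> (G *v w) = w \<bullet> (G *v u)"
        using inner_symmetric_matrix[OF sym, of u w] by (simp add: inner_commute)
      have ww: "w \<bullet> w = \<mu> * (u \<bullet> w) - w \<bullet> (G *v u)"
        by (subst (2) w_def) (simp add: inner_diff_right inner_commute)
      have "h (u + t *\<^sub>R w) = \<mu> * (u \<bullet> u) - u \<bullet> (G *v u) + 2 * t * (\<mu> * (u \<bullet> w) - w \<bullet> (G *v u)) + t\<^sup>2 * h w"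
        unfolding h_def
        by (simp add: matrix_vector_right_distrib matrix_vector_mult_scaleR inner_add_left inner_add_right s
            inner_commute[of w u] algebra_simps power2_eq_square)
      then show ?thesis using uu by (simp add: ww \<mu>_def)
    qed
    finally show ?thesis .
  qed
  then have "w \<bullet> w = 0" by (rule linear_coefficient_zero)
  then have "G *v u = \<mu> *\<^sub>R u" by (simp add: w_def)
  with u that show thesis by blast
qed

definition orthonormal_basis :: "(real^'n) set \<Rightarrow> (real^'n) set \<Rightarrow> bool" where
  "orthonormal_basis E V \<longleftrightarrow>
     finite E \<and> (\<forall>u\<in>E. \<forall>v\<in>E. u \<bullet> v = (if u = v then 1 else 0)) \<and> span E = V"

text \<open>Induction on the dimension: symmetry makes the orthogonal complement of an eigenvector
  inside the invariant subspace invariant again.\<close>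

lemma symmetric_eigenbasis_subspace:
  fixes G :: "real^'n^'n"
  assumes sym: "transpose G = G" and "subspace V" "\<And>v. v \<in> V \<Longrightarrow> G *v v \<in> V"
  shows "\<exists>E. orthonormal_basis E V \<and> (\<forall>v\<in>E. \<exists>\<mu>. G *v v = \<mu> *\<^sub>R v)"
  using assms(2,3)
proof (induction "dim V" arbitrary: V rule: less_induct)
  case less
  show ?case
  proof (cases "V = {0}")
    case True
    then show ?thesis by (intro exI[of _ "{}"]) (auto simp: orthonormal_basis_def)
  next
    case False
    then obtain u \<mu> where u: "u \<in> V" "norm u = 1" "G *v u = \<mu> *\<^sub>R u"
      using symmetric_has_eigenvector_in_subspace[OF sym] less.prems by metis
    have uu: "u \<bullet> u = 1" using u by (simp add: norm_eq_1)
    define V' where "V' = {w \<in> V. u \<bullet> w = 0}"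
    have V': "subspace V'"
      using less.prems unfolding V'_def subspace_def by (auto simp: inner_add_right)
    have "u \<notin> V'" using uu by (simp add: V'_def)
    moreover have "V' \<subseteq> V" by (auto simp: V'_def)
    ultimately have "V' \<subset> V" using u by blast
    then have "dim V' < dim V"
      using V' less.prems by (metis dim_psubset span_eq_iff)
    moreover have "G *v v \<in> V'" if "v \<in> V'" for v
      using that less.prems u inner_symmetric_matrix[OF sym, of u v] by (auto simp: V'_def)
    ultimately obtain E where E: "orthonormal_basis E V'" and eig: "\<forall>v\<in>E. \<exists>\<mu>. G *v v = \<mu> *\<^sub>R v"
      using less.hyps V' by blast
    have EV': "E \<subseteq> V'" using E by (auto simp: orthonormal_basis_def span_base)
    have "span (insert u E) = V"
    proof
      show "span (insert u E) \<subseteq> V"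
        using EV' u less.prems by (intro span_minimal) (auto simp: V'_def)
      show "V \<subseteq> span (insert u E)"
      proof
        fix v assume v: "v \<in> V"
        have "v - (u \<bullet> v) *\<^sub>R u \<in> V'"
          using v u uu less.prems by (auto simp: V'_def inner_diff_right intro: subspace_diff subspace_scale)
        then have "v - (u \<bullet> v) *\<^sub>R u \<in> span E" using E by (simp add: orthonormal_basis_def)
        then show "v \<in> span (insert u E)" using span_breakdown_eq by blast
      qed
    qed
    moreover have "u \<bullet> w = 0" "w \<bullet> u = 0" if "w \<in> E" for w
      using that EV' by (auto simp: V'_def inner_commute)
    moreover have "u \<notin> E" using EV' \<open>u \<notin> V'\<close> by blast
    ultimately have "orthonormal_basis (insert u E) V"
      using E uu unfolding orthonormal_basis_def by auto
    then show ?thesis using eig u by blast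
  qed
qed

lemma symmetric_eigenbasis:
  fixes G :: "real^'n^'n"
  assumes "transpose G = G"
  obtains E \<mu> where "orthonormal_basis E UNIV" "\<And>v. v \<in> E \<Longrightarrow> G *v v = \<mu> v *\<^sub>R v"
proof -
  obtain E where E: "orthonormal_basis E UNIV" and "\<forall>v\<in>E. \<exists>\<mu>. G *v v = \<mu> *\<^sub>R v"
    using symmetric_eigenbasis_subspace[OF assms, of UNIV] by auto
  then obtain \<mu> where "\<forall>v\<in>E. G *v v = \<mu> v *\<^sub>R v" using bchoice by metis
  with E that show thesis by blast
qed

lemma matrix_eq_on_orthonormal_basis:
  fixes X Y :: "real^'n^'m"
  assumes "orthonormal_basis E UNIV" "\<And>v. v \<in> E \<Longrightarrow> X *v v = Y *v v"
  shows "X = Y"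
proof -
  have "X *v v = Y *v v" for v
    using assms linear_eq_on_span[of "(*v) X" "(*v) Y" E v] by (auto simp: orthonormal_basis_def)
  then show ?thesis by (simp add: matrix_eq)
qed

text \<open>The converse of diagonalisation. It supplies both the square root and the pseudoinverse as
  functions of a symmetric matrix with the given eigenbasis.\<close>

lemma matrix_with_eigenvalues:
  fixes E :: "(real^'n) set" and c :: "real^'n \<Rightarrow> real"
  assumes E: "orthonormal_basis E UNIV"
  obtains C where "transpose C = C" "\<And>v. v \<in> E \<Longrightarrow> C *v v = c v *\<^sub>R v"
    "(\<And>v. v \<in> E \<Longrightarrow> 0 \<le> c v) \<Longrightarrow> pos_semidef C"
proof -
  define C where "C = matrix (\<lambda>x. \<Sum>v\<in>E. (c v * (v \<bullet> x)) *\<^sub>R v)"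
  have lin: "linear (\<lambda>x. \<Sum>v\<in>E. (c v * (v \<bullet> x)) *\<^sub>R v)"
    by (intro linearI) (simp_all add: inner_add_right algebra_simps sum.distrib scaleR_sum_right)
  have C: "C *v x = (\<Sum>v\<in>E. (c v * (v \<bullet> x)) *\<^sub>R v)" for x
    unfolding C_def using matrix_vector_mul(2)[OF lin] by metis
  have form: "y \<bullet> (C *v x) = (\<Sum>v\<in>E. c v * (v \<bullet> x) * (v \<bullet> y))" for x y
    by (simp add: C inner_sum_right inner_commute[of y])
  have "(transpose C *v y) \<bullet> x = (C *v y) \<bullet> x" for x y
    using form[of y x] form[of x y] inner_matrix_vector[of y C x]
    by (simp add: inner_commute[of _ x] mult_ac del: transpose_matrix_vector)
  then have sym: "transpose C = C"
    unfolding matrix_eq by (metis vector_eq_rdot)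
  have "C *v v = c v *\<^sub>R v" if "v \<in> E" for v
  proof -
    have "C *v v = (\<Sum>u\<in>E. if u = v then c v *\<^sub>R v else 0)"
      unfolding C using E that by (intro sum.cong) (auto simp: orthonormal_basis_def)
    then show ?thesis using E that by (simp add: orthonormal_basis_def)
  qed
  moreover have "pos_semidef C" if "\<And>v. v \<in> E \<Longrightarrow> 0 \<le> c v"
    unfolding pos_semidef_def form using sym that by (auto intro!: sum_nonneg simp: mult.assoc)
  ultimately show thesis using that sym by blast
qed

section \<open>Square root and pseudoinverse\<close>

text \<open>On the residual \<open>w = R v - \<mu> v\<close> the hypothesis forces \<open>R w = - \<mu> w\<close>, and a positive
  semidefinite matrix has no negative eigenvalue. For \<open>\<mu> = 0\<close> the residual is \<open>R v\<close>, whose squared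
  length is \<open>\<langle>v, R (R v)\<rangle> = 0\<close>.\<close>

lemma pos_semidef_sqrt_eigenvector:
  fixes R :: "real^'n^'n"
  assumes R: "pos_semidef R" and "0 \<le> \<mu>" and RR: "R *v (R *v v) = \<mu>\<^sup>2 *\<^sub>R v"
  shows "R *v v = \<mu> *\<^sub>R v"
proof (cases "\<mu> = 0")
  case True
  then have "(R *v v) \<bullet> (R *v v) = 0"
    using RR R inner_symmetric_matrix[of R v "R *v v"] by (simp add: pos_semidef_def)
  then show ?thesis using True by simp
next
  case False
  define w where "w = R *v v - \<mu> *\<^sub>R v"
  have "R *v w = - \<mu> *\<^sub>R w"
    by (simp add: w_def RR matrix_vector_mult_diff_distrib matrix_vector_mult_scaleR
        algebra_simps power2_eq_square)
  then have "w \<bullet> (R *v w) = - \<mu> * (w \<bullet> w)" by simp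
  moreover have "0 \<le> w \<bullet> (R *v w)" using R by (simp add: pos_semidef_def)
  ultimately have "\<mu> * (w \<bullet> w) \<le> 0" by simp
  then have "w \<bullet> w \<le> 0" using False \<open>0 \<le> \<mu>\<close> by (simp add: mult_le_0_iff)
  then have "w = 0" using inner_gt_zero_iff[of w] by linarith
  then show ?thesis by (simp add: w_def)
qed

text \<open>An eigenvector of \<open>R\<close> for \<open>\<mu>\<close> is an eigenvector of the common square for \<open>\<mu>\<^sup>2\<close>, hence of \<open>R'\<close> for
  \<open>\<mu>\<close>; so the two roots agree on an eigenbasis of \<open>R\<close>.\<close>

lemma pos_semidef_sqrt_unique:
  fixes R R' :: "real^'n^'n"
  assumes R: "pos_semidef R" and R': "pos_semidef R'" and eq: "R ** R = R' ** R'"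
  shows "R = R'"
proof -
  have "transpose R = R" using R by (simp add: pos_semidef_def)
  then obtain E \<mu> where E: "orthonormal_basis E UNIV" and \<mu>: "\<And>v. v \<in> E \<Longrightarrow> R *v v = \<mu> v *\<^sub>R v"
    using symmetric_eigenbasis by metis
  show ?thesis
  proof (rule matrix_eq_on_orthonormal_basis[OF E])
    fix v assume v: "v \<in> E"
    then have "0 \<le> v \<bullet> (R *v v)" "v \<bullet> v = 1" using R E by (auto simp: pos_semidef_def orthonormal_basis_def)
    then have "0 \<le> \<mu> v" by (simp add: \<mu>[OF v])
    moreover have "R' *v (R' *v v) = (\<mu> v)\<^sup>2 *\<^sub>R v"
    proof -
      have "R' *v (R' *v v) = R *v (R *v v)" by (simp add: matrix_vector_mul_assoc eq)
      then show ?thesis by (simp add: \<mu>[OF v] matrix_vector_mult_scaleR power2_eq_square)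
    qed
    ultimately have "R' *v v = \<mu> v *\<^sub>R v" by (rule pos_semidef_sqrt_eigenvector[OF R'])
    then show "R *v v = R' *v v" using \<mu>[OF v] by simp
  qed
qed

lemma msqrt_pos_semidef:
  fixes G :: "real^'n^'n"
  assumes G: "pos_semidef G"
  shows "pos_semidef (msqrt G)" "msqrt G ** msqrt G = G"
proof -
  have "transpose G = G" using G by (simp add: pos_semidef_def)
  then obtain E \<mu> where E: "orthonormal_basis E UNIV" and \<mu>: "\<And>v. v \<in> E \<Longrightarrow> G *v v = \<mu> v *\<^sub>R v"
    using symmetric_eigenbasis by metis
  have pos: "0 \<le> \<mu> v" if "v \<in> E" for v
  proof -
    have "0 \<le> v \<bullet> (G *v v)" "v \<bullet> v = 1"
      using G E that by (auto simp: pos_semidef_def orthonormal_basis_def)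
    then show ?thesis by (simp add: \<mu>[OF that])
  qed
  obtain R where R: "\<And>v. v \<in> E \<Longrightarrow> R *v v = sqrt (\<mu> v) *\<^sub>R v" "pos_semidef R"
    using matrix_with_eigenvalues[OF E, of "\<lambda>v. sqrt (\<mu> v)"] pos by (metis real_sqrt_ge_zero)
  have "R ** R = G"
    using R(1) \<mu> pos
    by (intro matrix_eq_on_orthonormal_basis[OF E])
      (simp add: matrix_vector_mult_scaleR flip: matrix_vector_mul_assoc)
  moreover have "R' = R" if "pos_semidef R' \<and> R' ** R' = G" for R'
    by (rule pos_semidef_sqrt_unique) (use that R(2) \<open>R ** R = G\<close> in simp_all)
  ultimately have "msqrt G = R"
    unfolding msqrt_def using R(2) by (intro the_equality) blast+
  then show "pos_semidef (msqrt G)" "msqrt G ** msqrt G = G"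
    using R(2) \<open>R ** R = G\<close> by simp_all
qed

lemma is_pinv_unique:
  fixes M :: "real^'n^'m"
  assumes X: "is_pinv M X" and Y: "is_pinv M Y"
  shows "X = Y"
proof -
  have MXMY: "M ** X = M ** Y"
  proof -
    have "M ** X = transpose (M ** X)" using X by (simp add: is_pinv_def)
    also have "\<dots> = transpose ((M ** Y) ** (M ** X))" using Y by (simp add: is_pinv_def matrix_mul_assoc)
    also have "\<dots> = transpose (M ** X) ** transpose (M ** Y)" by (simp only: matrix_transpose_mul)
    also have "\<dots> = (M ** X) ** (M ** Y)" using X Y by (simp add: is_pinv_def)
    also have "\<dots> = M ** Y" using X by (simp add: is_pinv_def matrix_mul_assoc)
    finally show ?thesis .
  qed
  have XMYM: "X ** M = Y ** M"
  proof -
    have "X ** M = transpose (X ** M)" using X by (simp add: is_pinv_def)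
    also have "\<dots> = transpose ((X ** M) ** (Y ** M))"
      using Y by (metis is_pinv_def matrix_mul_assoc)
    also have "\<dots> = transpose (Y ** M) ** transpose (X ** M)" by (simp only: matrix_transpose_mul)
    also have "\<dots> = (Y ** M) ** (X ** M)" using X Y by (simp add: is_pinv_def)
    also have "\<dots> = Y ** M" using X by (metis is_pinv_def matrix_mul_assoc)
    finally show ?thesis .
  qed
  have "X = X ** (M ** X)" using X by (simp add: is_pinv_def matrix_mul_assoc)
  also have "\<dots> = (Y ** M) ** Y" by (simp add: MXMY matrix_mul_assoc XMYM)
  also have "\<dots> = Y" using Y by (simp add: is_pinv_def)
  finally show ?thesis .
qed

text \<open>On an eigenbasis the pseudoinverse inverts the nonzero eigenvalues and keeps the zero ones; the
  convention \<open>inverse 0 = 0\<close> expresses exactly this.\<close>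

lemma pinv_symmetric:
  fixes M :: "real^'n^'n"
  assumes sym: "transpose M = M"
  shows "is_pinv M (pinv M)" "transpose (pinv M) = pinv M"
proof -
  obtain E \<mu> where E: "orthonormal_basis E UNIV" and \<mu>: "\<And>v. v \<in> E \<Longrightarrow> M *v v = \<mu> v *\<^sub>R v"
    using symmetric_eigenbasis[OF sym] by metis
  obtain X where symX: "transpose X = X" and X: "\<And>v. v \<in> E \<Longrightarrow> X *v v = inverse (\<mu> v) *\<^sub>R v"
    using matrix_with_eigenvalues[OF E, of "\<lambda>v. inverse (\<mu> v)"] by metis
  have comm: "M ** X = X ** M"
    by (intro matrix_eq_on_orthonormal_basis[OF E])
      (simp add: \<mu> X matrix_vector_mult_scaleR flip: matrix_vector_mul_assoc)
  have "\<mu> v * (inverse (\<mu> v) * \<mu> v) = \<mu> v" "inverse (\<mu> v) * (\<mu> v * inverse (\<mu> v)) = inverse (\<mu> v)" for v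
    by (cases "\<mu> v = 0"; simp)+
  then have "M ** X ** M = M" "X ** M ** X = X"
    using \<mu> X by (intro matrix_eq_on_orthonormal_basis[OF E];
        simp add: matrix_vector_mult_scaleR mult_ac flip: matrix_vector_mul_assoc)+
  then have "is_pinv M X"
    using comm by (simp add: is_pinv_def matrix_transpose_mul sym symX)
  then have "pinv M = X"
    unfolding pinv_def by (blast intro: the_equality is_pinv_unique)
  then show "is_pinv M (pinv M)" "transpose (pinv M) = pinv M"
    using \<open>is_pinv M X\<close> symX by auto
qed

section \<open>Positive definite matrices\<close>

lemma matrix_inv_inverse:
  assumes "invertible A"
  shows "A ** matrix_inv A = mat 1" "matrix_inv A ** A = mat 1"
proof -
  have "A ** matrix_inv A = mat 1 \<and> matrix_inv A ** A = mat 1"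
    using assms someI_ex[of "\<lambda>X. A ** X = mat 1 \<and> X ** A = mat 1"]
    unfolding invertible_def matrix_inv_def by blast
  then show "A ** matrix_inv A = mat 1" "matrix_inv A ** A = mat 1" by auto
qed

lemma pos_def_imp_pos_semidef: "pos_def G \<Longrightarrow> pos_semidef G"
  unfolding pos_def_def pos_semidef_def by (metis inner_zero_left less_eq_real_def)

lemma mnorm_sq_nonneg: "pos_semidef G \<Longrightarrow> 0 \<le> mnorm_sq G v"
  by (simp add: pos_semidef_def mnorm_sq_def)

lemma mnorm_sq_pos: "pos_def G \<Longrightarrow> v \<noteq> 0 \<Longrightarrow> 0 < mnorm_sq G v"
  by (simp add: pos_def_def mnorm_sq_def)

lemma mnorm_sq_zero [simp]: "mnorm_sq G 0 = 0"
  by (simp add: mnorm_sq_def)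

lemma pos_def_matrix_inv:
  fixes B :: "real^'n^'n"
  assumes B: "pos_def B"
  shows "B ** matrix_inv B = mat 1" "matrix_inv B ** B = mat 1" "pos_def (matrix_inv B)"
proof -
  have "v = 0" if "B *v v = 0" for v
  proof (rule ccontr)
    assume "v \<noteq> 0"
    then have "0 < v \<bullet> (B *v v)" using B by (simp add: pos_def_def)
    then show False using that by simp
  qed
  then have "invertible B"
    by (auto simp: invertible_left_inverse matrix_left_invertible_ker)
  note inv = matrix_inv_inverse[OF this]
  then show "B ** matrix_inv B = mat 1" "matrix_inv B ** B = mat 1" by auto
  have symB: "transpose B = B" using B by (simp add: pos_def_def)
  have "transpose (matrix_inv B) = transpose (matrix_inv B) ** (B ** matrix_inv B)"
    by (simp add: inv)
  also have "\<dots> = transpose (B ** matrix_inv B) ** matrix_inv B"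
    by (simp only: matrix_transpose_mul symB matrix_mul_assoc)
  also have "\<dots> = matrix_inv B" by (simp add: inv)
  finally have sym: "transpose (matrix_inv B) = matrix_inv B" .
  moreover have "0 < v \<bullet> (matrix_inv B *v v)" if "v \<noteq> 0" for v
  proof -
    have v: "v = B *v (matrix_inv B *v v)"
      by (simp add: matrix_vector_mul_assoc inv)
    then have "matrix_inv B *v v \<noteq> 0" using that by (metis matrix_vector_mult_0_right)
    then have "0 < (matrix_inv B *v v) \<bullet> (B *v (matrix_inv B *v v))" using B by (simp add: pos_def_def)
    also have "\<dots> = v \<bullet> (matrix_inv B *v v)" by (simp add: inner_commute flip: v)
    finally show ?thesis .
  qed
  ultimately show "pos_def (matrix_inv B)" by (simp add: pos_def_def)
qed

section \<open>One step of sketch-and-project\<close>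

lemma sketch_gram_symmetric:
  assumes "pos_def B"
  shows "transpose (A ** matrix_inv B ** transpose A) = A ** matrix_inv B ** transpose A"
  using pos_def_matrix_inv(3)[OF assms]
  by (simp add: pos_def_def matrix_transpose_mul matrix_mul_assoc)

text \<open>With \<open>M\<close> the sketched Gram matrix \<open>S\<^sub>i\<^sup>T W S\<^sub>i\<close>, the product \<open>H\<^sub>i W H\<^sub>i\<close> is
  \<open>S\<^sub>i (M\<^sup>\<dagger> M M\<^sup>\<dagger>) S\<^sub>i\<^sup>T\<close>. This identity is what turns the step into a projection.\<close>

lemma sketch_H_symmetric:
  assumes "pos_def B"
  shows "transpose (sketch_H A B S i) = sketch_H A B S i"
    and "sketch_H A B S i ** (A ** matrix_inv B ** transpose A) ** sketch_H A B S i = sketch_H A B S i"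
proof -
  define G where "G = transpose (S i) ** A ** matrix_inv B ** transpose A ** S i"
  have "transpose G = G"
    using pos_def_matrix_inv(3)[OF assms]
    by (simp add: G_def pos_def_def matrix_transpose_mul matrix_mul_assoc)
  note G = pinv_symmetric[OF this]
  have H: "sketch_H A B S i = S i ** pinv G ** transpose (S i)"
    by (simp add: sketch_H_def G_def)
  show "transpose (sketch_H A B S i) = sketch_H A B S i"
    by (simp add: H matrix_transpose_mul matrix_mul_assoc G)
  have "sketch_H A B S i ** (A ** matrix_inv B ** transpose A) ** sketch_H A B S i
      = S i ** (pinv G ** G ** pinv G) ** transpose (S i)"
    unfolding H by (simp add: G_def matrix_mul_assoc)
  then show "sketch_H A B S i ** (A ** matrix_inv B ** transpose A) ** sketch_H A B S i = sketch_H A B S i"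
    using G by (simp add: is_pinv_def H)
qed

lemma sketch_loss_eq:
  assumes "A *v xs = b"
  shows "sketch_loss A b B S i x = mnorm_sq (sketch_H A B S i) (A *v (x - xs))"
  by (simp add: sketch_loss_def matrix_vector_mult_diff_distrib assms)

text \<open>Expand the square of \<open>e - d\<close> with \<open>d = B\<^sup>-\<^sup>1 A\<^sup>T H\<^sub>i A e\<close>. The cross term and the quadratic term in \<open>d\<close> are both
  multiples of \<open>\<parallel>A e\<parallel>\<^sup>2\<close> in the \<open>H\<^sub>i\<close>-seminorm, the quadratic one by \<open>H\<^sub>i W H\<^sub>i = H\<^sub>i\<close>, and they
  combine with coefficient \<open>- 2 + 1\<close>.\<close>

lemma mnorm_sq_residual_step:
  assumes B: "pos_def B"
  shows "mnorm_sq B (e - matrix_inv B *v (transpose A *v (sketch_H A B S i *v (A *v e))))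
       = mnorm_sq B e - mnorm_sq (sketch_H A B S i) (A *v e)"
proof -
  define H where "H = sketch_H A B S i"
  define u where "u = A *v e"
  define g where "g = transpose A *v (H *v u)"
  define d where "d = matrix_inv B *v g"
  have Bd: "B *v d = g"
    by (simp add: d_def matrix_vector_mul_assoc pos_def_matrix_inv(1)[OF B])
  have eg: "e \<bullet> g = u \<bullet> (H *v u)"
    using inner_matrix_vector[of "H *v u" A e] by (simp only: g_def u_def inner_commute)
  have Be: "d \<bullet> (B *v e) = g \<bullet> e"
    using B inner_symmetric_matrix[of B d e] by (simp add: pos_def_def Bd)
  have "g \<bullet> d = (H *v u) \<bullet> (A *v d)"
    unfolding g_def by (rule inner_matrix_vector[symmetric])
  also have "\<dots> = u \<bullet> (H *v (A *v d))"
    by (rule inner_symmetric_matrix[symmetric]) (simp add: H_def sketch_H_symmetric(1)[OF B])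
  also have "H *v (A *v d) = (H ** (A ** matrix_inv B ** transpose A) ** H) *v u"
    unfolding d_def g_def by (simp only: matrix_vector_mul_assoc matrix_mul_assoc)
  also have "\<dots> = H *v u" by (simp only: H_def sketch_H_symmetric(2)[OF B])
  finally have gd: "g \<bullet> d = u \<bullet> (H *v u)" .
  have "mnorm_sq B (e - d) = mnorm_sq B e - e \<bullet> g - d \<bullet> (B *v e) + d \<bullet> g"
    by (simp add: mnorm_sq_def matrix_vector_mult_diff_distrib Bd inner_diff_left inner_diff_right)
  also have "\<dots> = mnorm_sq B e - u \<bullet> (H *v u)"
    using eg gd Be by (simp add: inner_commute)
  finally show ?thesis by (simp only: mnorm_sq_def d_def g_def u_def H_def)
qed

lemma sketch_step_error:
  assumes "A *v xs = b"
  shows "sketch_step A b B S i x - xs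
       = (x - xs) - matrix_inv B *v (transpose A *v (sketch_H A B S i *v (A *v (x - xs))))"
proof -
  have "A *v x - b = A *v (x - xs)" by (simp add: matrix_vector_mult_diff_distrib assms)
  then show ?thesis
    by (simp add: sketch_step_def matrix_vector_mul_assoc[symmetric] del: transpose_matrix_vector)
qed

lemma mnorm_sq_sketch_step:
  assumes "pos_def B" "A *v xs = b"
  shows "mnorm_sq B (sketch_step A b B S i x - xs) = mnorm_sq B (x - xs) - sketch_loss A b B S i x"
  using assms by (simp only: sketch_step_error mnorm_sq_residual_step sketch_loss_eq)

text \<open>A projection cannot remove more than the whole error; this keeps the spectral constants at most \<open>1\<close>.\<close>

lemma sketch_H_form_le:
  assumes B: "pos_def B"
  shows "mnorm_sq (sketch_H A B S i) (A *v v) \<le> mnorm_sq B v"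
  using mnorm_sq_residual_step[OF B, of v A S i]
    mnorm_sq_nonneg[OF pos_def_imp_pos_semidef[OF B],
      of "v - matrix_inv B *v (transpose A *v (sketch_H A B S i *v (A *v v)))"]
  by linarith

text \<open>The factors \<open>B\<^sup>-\<^sup>1\<^sup>/\<^sup>2\<close> in \<open>Z\<^sub>i\<close> cancel against \<open>B\<^sup>1\<^sup>/\<^sup>2 v\<close>, so the numerators of the spectral quotients are the
  losses.\<close>

lemma mnorm_sq_sketch_Z:
  fixes B :: "real^'n^'n"
  assumes B: "pos_def B"
  shows "mnorm_sq (sketch_Z A B S i) (msqrt B *v v) = mnorm_sq (sketch_H A B S i) (A *v v)"
proof -
  define R where "R = msqrt B"
  have R: "transpose R = R" "R ** R = B"
    using msqrt_pos_semidef[OF pos_def_imp_pos_semidef[OF B]] by (auto simp: R_def pos_semidef_def)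
  have "R ** (R ** matrix_inv B) = mat 1"
    by (simp add: matrix_mul_assoc R pos_def_matrix_inv[OF B])
  then have "invertible R" using matrix_left_right_inverse invertible_left_inverse by blast
  note inv = matrix_inv_inverse[OF this]
  let ?w = "transpose A *v (sketch_H A B S i *v (A *v v))"
  have "mnorm_sq (sketch_Z A B S i) (R *v v)
      = (R *v v) \<bullet> (matrix_inv R *v (transpose A *v (sketch_H A B S i *v (A *v ((matrix_inv R ** R) *v v)))))"
    by (simp only: mnorm_sq_def sketch_Z_def R_def matrix_vector_mul_assoc matrix_mul_assoc)
  also have "\<dots> = (R *v v) \<bullet> (matrix_inv R *v ?w)"
    by (simp only: inv matrix_vector_mul_lid)
  also have "\<dots> = v \<bullet> (R *v (matrix_inv R *v ?w))"
    by (rule inner_symmetric_matrix[OF R(1), symmetric])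
  also have "\<dots> = v \<bullet> ((R ** matrix_inv R) *v ?w)"
    by (subst matrix_vector_mul_assoc) (rule refl)
  also have "\<dots> = (A *v v) \<bullet> (sketch_H A B S i *v (A *v v))"
    using inner_matrix_vector[of "sketch_H A B S i *v (A *v v)" A v] by (simp only: inv matrix_vector_mul_lid inner_commute)
  finally show ?thesis by (simp only: mnorm_sq_def R_def)
qed

lemma mnorm_sq_mean:
  fixes Z :: "'q::finite \<Rightarrow> real^'n^'n"
  shows "mnorm_sq (mean p Z) v = mean p (\<lambda>i. mnorm_sq (Z i) v)"
proof -
  have "(\<Sum>i\<in>J. p $ i *\<^sub>R Z i) *v v = (\<Sum>i\<in>J. p $ i *\<^sub>R (Z i *v v))" for J
    by (induction J rule: infinite_finite_induct)
      (simp_all add: matrix_vector_mult_add_rdistrib scaleR_matrix_vector_assoc)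
  then show ?thesis by (simp add: mnorm_sq_def mean_def inner_sum_right)
qed

section \<open>The spectral constants\<close>

lemma subspace_mrange: "subspace (mrange M)"
  unfolding mrange_def by (intro linear_subspace_image) auto

lemma mrange_inverse_transpose_nontrivial:
  fixes A :: "real^'n^'m"
  assumes "A \<noteq> 0" and B: "pos_def B"
  shows "mrange (matrix_inv B ** transpose A) \<noteq> {0}"
proof
  assume zero: "mrange (matrix_inv B ** transpose A) = {0}"
  have "transpose A *v y = 0" for y
  proof -
    have "(matrix_inv B ** transpose A) *v y \<in> mrange (matrix_inv B ** transpose A)"
      by (simp add: mrange_def)
    then have "B *v ((matrix_inv B ** transpose A) *v y) = 0" using zero by simp
    then show ?thesis
      by (simp only: matrix_vector_mul_assoc matrix_mul_assoc pos_def_matrix_inv(1)[OF B] matrix_mul_lid)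
  qed
  then have "transpose A = 0" by (simp add: matrix_eq del: transpose_matrix_vector)
  then have "A = 0" by (simp add: transpose_def vec_eq_iff)
  then show False using \<open>A \<noteq> 0\<close> by simp
qed

lemma continuous_on_Max_finite:
  fixes f :: "'i \<Rightarrow> 'a::topological_space \<Rightarrow> real"
  assumes "finite I" "I \<noteq> {}" "\<And>i. i \<in> I \<Longrightarrow> continuous_on T (f i)"
  shows "continuous_on T (\<lambda>x. Max ((\<lambda>i. f i x) ` I))"
  using assms
proof (induction I rule: finite_ne_induct)
  case (insert j J)
  then have "continuous_on T (\<lambda>x. max (f j x) (Max ((\<lambda>i. f i x) ` J)))"
    by (intro continuous_on_max) auto
  then show ?case using insert by simp
qed simp

text \<open>Scale invariance reduces the infimum over all nonzero vectors to the unit sphere of the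
  subspace, which is compact. Without attainment the \<open>LEAST\<close> would be an unspecified number.\<close>

lemma Least_quotient_attained:
  fixes f :: "'a::euclidean_space \<Rightarrow> real"
  assumes V: "subspace V" "V \<noteq> {0}"
    and cont: "continuous_on (V \<inter> sphere 0 1) f"
    and scale: "\<And>c v. 0 < c \<Longrightarrow> f (c *\<^sub>R v) = f v"
  shows "\<exists>v\<in>V. v \<noteq> 0 \<and> (LEAST s. s \<in> {f v | v. v \<in> V \<and> v \<noteq> 0}) = f v"
    and "v \<in> V \<Longrightarrow> v \<noteq> 0 \<Longrightarrow> (LEAST s. s \<in> {f v | v. v \<in> V \<and> v \<noteq> 0}) \<le> f v"
proof -
  have norm1: "v /\<^sub>R norm v \<in> V \<inter> sphere 0 1" if "v \<in> V" "v \<noteq> 0" for v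
    using that V by (auto simp: subspace_scale)
  obtain v0 where "v0 \<in> V" "v0 \<noteq> 0" using V subspace_0 by blast
  then have "V \<inter> sphere 0 1 \<noteq> {}" using norm1 by blast
  moreover have "compact (V \<inter> sphere 0 1)"
    using V by (intro closed_Int_compact closed_subspace compact_sphere)
  ultimately obtain u where u: "u \<in> V \<inter> sphere 0 1" and min: "\<forall>v\<in>V \<inter> sphere 0 1. f u \<le> f v"
    using continuous_attains_inf cont by blast
  have le: "f u \<le> f v" if "v \<in> V" "v \<noteq> 0" for v
  proof -
    have "f u \<le> f (v /\<^sub>R norm v)" using min norm1[OF that] by blast
    also have "\<dots> = f v" using that by (intro scale) simp
    finally show ?thesis .
  qed
  have u': "u \<in> V" "u \<noteq> 0" using u by auto
  have least: "(LEAST s. s \<in> {f v | v. v \<in> V \<and> v \<noteq> 0}) = f u"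
    using u' le by (intro Least_equality) auto
  show "\<exists>v\<in>V. v \<noteq> 0 \<and> (LEAST s. s \<in> {f v | v. v \<in> V \<and> v \<noteq> 0}) = f v"
    using u' least by blast
  show "(LEAST s. s \<in> {f v | v. v \<in> V \<and> v \<noteq> 0}) \<le> f v" if "v \<in> V" "v \<noteq> 0"
    using le[OF that] least by simp
qed

lemma mnorm_sq_scaleR: "mnorm_sq G (c *\<^sub>R v) = c\<^sup>2 * mnorm_sq G v"
  by (simp add: mnorm_sq_def matrix_vector_mult_scaleR power2_eq_square)

lemma continuous_on_mnorm_sq:
  fixes G :: "real^'n^'n"
  assumes "continuous_on T f"
  shows "continuous_on T (\<lambda>v. mnorm_sq G (f v))"
  unfolding mnorm_sq_def
  using assms by (intro continuous_intros bounded_linear.continuous_on[of "(*v) G"]) (auto simp flip: linear_conv_bounded_linear)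

lemma mnorm_sq_quotient_scale:
  assumes "0 < c"
  shows "mnorm_sq G (M *v (c *\<^sub>R v)) / mnorm_sq B (c *\<^sub>R v) = mnorm_sq G (M *v v) / mnorm_sq B v"
  using assms by (simp add: matrix_vector_mult_scaleR mnorm_sq_scaleR)

lemma continuous_on_mnorm_sq_quotient:
  fixes M :: "real^'n^'n"
  assumes "pos_def B"
  shows "continuous_on (V \<inter> sphere 0 1) (\<lambda>v. mnorm_sq G (M *v v) / mnorm_sq B v)"
proof (intro continuous_on_divide continuous_on_mnorm_sq ballI)
  show "continuous_on (V \<inter> sphere 0 1) ((*v) M)"
    by (intro linear_continuous_on linear_conv_bounded_linear[THEN iffD1]) auto
  show "mnorm_sq B v \<noteq> 0" if "v \<in> V \<inter> sphere 0 1" for v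
  proof -
    have "v \<noteq> 0" using that by auto
    then show ?thesis using mnorm_sq_pos[OF assms] by force
  qed
qed (rule continuous_on_id)

text \<open>The lower bound on the loss is what makes the method contract; the bound by \<open>1\<close> is needed because
  the contraction can be iterated only if its factor is nonnegative.\<close>

lemma sigma_max_sq:
  fixes A :: "real^'n^'m" and S :: "'q::finite \<Rightarrow> real^'t^'m"
  assumes A: "A \<noteq> 0" and B: "pos_def B"
  shows "v \<in> mrange (matrix_inv B ** transpose A) \<Longrightarrow>
           sigma_max_sq A B S * mnorm_sq B v \<le> (MAX i. mnorm_sq (sketch_H A B S i) (A *v v))"
    and "sigma_max_sq A B S \<le> 1"
proof -
  let ?V = "mrange (matrix_inv B ** transpose A)"
  define f where "f = (\<lambda>v. MAX i. mnorm_sq (sketch_Z A B S i) (msqrt B *v v) / mnorm_sq B v)"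
  have sig: "sigma_max_sq A B S = (LEAST s. s \<in> {f v | v. v \<in> ?V \<and> v \<noteq> 0})"
    by (simp add: sigma_max_sq_def f_def)
  have cont: "continuous_on (?V \<inter> sphere 0 1) f"
    unfolding f_def by (intro continuous_on_Max_finite continuous_on_mnorm_sq_quotient B) auto
  have scale: "f (c *\<^sub>R v) = f v" if "0 < c" for c v
    using that by (simp only: f_def mnorm_sq_quotient_scale)
  note attained = Least_quotient_attained[OF subspace_mrange mrange_inverse_transpose_nontrivial[OF A B] cont]
  have least: "sigma_max_sq A B S \<le> f v" if "v \<in> ?V" "v \<noteq> 0" for v
    unfolding sig by (rule attained(2)) (use scale that in auto)
  show "sigma_max_sq A B S * mnorm_sq B v \<le> (MAX i. mnorm_sq (sketch_H A B S i) (A *v v))" if v: "v \<in> ?V"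
  proof (cases "v = 0")
    case False
    have "f v \<in> range (\<lambda>i. mnorm_sq (sketch_Z A B S i) (msqrt B *v v) / mnorm_sq B v)"
      unfolding f_def by (intro Max_in) auto
    then obtain i where "f v = mnorm_sq (sketch_Z A B S i) (msqrt B *v v) / mnorm_sq B v"
      by blast
    then have "sigma_max_sq A B S * mnorm_sq B v \<le> mnorm_sq (sketch_H A B S i) (A *v v)"
      using least[OF v False] mnorm_sq_pos[OF B False] by (simp add: pos_le_divide_eq mnorm_sq_sketch_Z[OF B])
    also have "\<dots> \<le> (MAX i. mnorm_sq (sketch_H A B S i) (A *v v))" by (intro Max_ge) auto
    finally show ?thesis .
  qed simp
  obtain v where v: "v \<noteq> 0" "sigma_max_sq A B S = f v"
    using attained(1) scale unfolding sig by blast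
  have "f v \<le> 1"
    unfolding f_def using mnorm_sq_pos[OF B v(1)]
    by (intro Max.boundedI) (auto simp: mnorm_sq_sketch_Z[OF B] sketch_H_form_le[OF B])
  then show "sigma_max_sq A B S \<le> 1" using v by simp
qed

lemma mean_le_bound:
  assumes "p \<in> prob_simplex" "\<And>i. f i \<le> (c :: real)"
  shows "mean p f \<le> c"
proof -
  have "mean p f \<le> (\<Sum>i\<in>UNIV. p $ i * c)"
    unfolding mean_def using assms by (auto intro!: sum_mono mult_left_mono simp: prob_simplex_def)
  also have "\<dots> = c" using assms by (simp add: prob_simplex_def flip: sum_distrib_right)
  finally show ?thesis .
qed

lemma sigma_mean_sq:
  fixes A :: "real^'n^'m" and S :: "'q::finite \<Rightarrow> real^'t^'m"
  assumes A: "A \<noteq> 0" and B: "pos_def B" and p: "p \<in> prob_simplex"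
  shows "v \<in> mrange (matrix_inv B ** transpose A) \<Longrightarrow>
           sigma_mean_sq A B S p * mnorm_sq B v \<le> mean p (\<lambda>i. mnorm_sq (sketch_H A B S i) (A *v v))"
    and "sigma_mean_sq A B S p \<le> 1"
proof -
  let ?V = "mrange (matrix_inv B ** transpose A)"
  define f where "f = (\<lambda>v. mnorm_sq (mean p (sketch_Z A B S)) (msqrt B *v v) / mnorm_sq B v)"
  have sig: "sigma_mean_sq A B S p = (LEAST s. s \<in> {f v | v. v \<in> ?V \<and> v \<noteq> 0})"
    by (simp add: sigma_mean_sq_def f_def)
  have cont: "continuous_on (?V \<inter> sphere 0 1) f"
    unfolding f_def by (intro continuous_on_mnorm_sq_quotient B)
  have scale: "f (c *\<^sub>R v) = f v" if "0 < c" for c v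
    using that by (simp only: f_def mnorm_sq_quotient_scale)
  have f: "f v = mean p (\<lambda>i. mnorm_sq (sketch_H A B S i) (A *v v)) / mnorm_sq B v" for v
    by (simp add: f_def mnorm_sq_mean mnorm_sq_sketch_Z[OF B])
  note attained = Least_quotient_attained[OF subspace_mrange mrange_inverse_transpose_nontrivial[OF A B] cont]
  have least: "sigma_mean_sq A B S p \<le> f v" if "v \<in> ?V" "v \<noteq> 0" for v
    unfolding sig by (rule attained(2)) (use scale that in auto)
  show "sigma_mean_sq A B S p * mnorm_sq B v \<le> mean p (\<lambda>i. mnorm_sq (sketch_H A B S i) (A *v v))" if v: "v \<in> ?V"
  proof (cases "v = 0")
    case False
    then show ?thesis
      using least[OF v False] mnorm_sq_pos[OF B False] by (simp add: pos_le_divide_eq f)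
  qed (simp add: mean_def)
  obtain v where v: "v \<noteq> 0" "sigma_mean_sq A B S p = f v"
    using attained(1) scale unfolding sig by blast
  have "mean p (\<lambda>i. mnorm_sq (sketch_H A B S i) (A *v v)) \<le> mnorm_sq B v"
    using p sketch_H_form_le[OF B] by (intro mean_le_bound)
  then show "sigma_mean_sq A B S p \<le> 1" using v mnorm_sq_pos[OF B v(1)] by (simp add: f)
qed

section \<open>The least-norm solution\<close>

text \<open>The candidate \<open>B\<^sup>-\<^sup>1 A\<^sup>T W\<^sup>\<dagger> b\<close> solves the system: its residual \<open>r\<close> satisfies \<open>W r = 0\<close>, hence
  \<open>\<parallel>A\<^sup>T r\<parallel>\<^sup>2 = 0\<close> in the norm of \<open>B\<^sup>-\<^sup>1\<close>, hence \<open>A\<^sup>T r = 0\<close>; as \<open>b\<close> is in the range of \<open>A\<close>, \<open>r\<close> is orthogonal to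
  itself. It is \<open>B\<close>-orthogonal to the kernel of \<open>A\<close>, so by Pythagoras every other solution
  has strictly larger norm.\<close>

lemma min_norm_solution:
  fixes A :: "real^'n^'m"
  assumes B: "pos_def B" and z: "A *v z = b"
  shows "A *v min_norm_solution A b B = b"
    and "min_norm_solution A b B \<in> mrange (matrix_inv B ** transpose A)"
proof -
  define W where "W = A ** matrix_inv B ** transpose A"
  have symW: "transpose W = W" unfolding W_def by (rule sketch_gram_symmetric[OF B])
  have pW: "is_pinv W (pinv W)" by (rule pinv_symmetric[OF symW])
  define y where "y = pinv W *v b"
  define r where "r = b - W *v y"
  have "W ** (W ** pinv W) = transpose (transpose (W ** pinv W) ** transpose W)"
    by (simp add: matrix_transpose_mul)
  also have "\<dots> = W" using pW symW by (simp add: is_pinv_def)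
  finally have "W *v r = 0"
    by (simp add: r_def y_def matrix_vector_mult_diff_distrib matrix_vector_mul_assoc)
  have "(transpose A *v r) \<bullet> (matrix_inv B *v (transpose A *v r)) = r \<bullet> (W *v r)"
    by (simp only: W_def flip: inner_matrix_vector matrix_vector_mul_assoc)
  then have "mnorm_sq (matrix_inv B) (transpose A *v r) = 0"
    using \<open>W *v r = 0\<close> by (simp only: mnorm_sq_def inner_zero_right)
  then have Ar: "transpose A *v r = 0"
    using mnorm_sq_pos[OF pos_def_matrix_inv(3)[OF B], of "transpose A *v r"] by force
  have "r \<bullet> b = 0" using inner_matrix_vector[of r A z] Ar z by simp
  moreover have "r \<bullet> (W *v y) = 0"
    using inner_symmetric_matrix[OF symW, of r y] \<open>W *v r = 0\<close> by simp
  ultimately have "r \<bullet> r = 0" by (subst (2) r_def) (simp add: inner_diff_right)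
  then have Wy: "W *v y = b" by (simp add: r_def)
  define xs where "xs = (matrix_inv B ** transpose A) *v y"
  have Axs: "A *v xs = b"
    using Wy by (simp only: xs_def W_def matrix_vector_mul_assoc matrix_mul_assoc)
  have Bxs: "B *v xs = transpose A *v y"
    by (simp only: xs_def matrix_vector_mul_assoc matrix_mul_assoc pos_def_matrix_inv(1)[OF B] matrix_mul_lid)
  have pyth: "mnorm_sq B x = mnorm_sq B xs + mnorm_sq B (x - xs)" if "A *v x = b" for x
  proof -
    have "(x - xs) \<bullet> (B *v xs) = (A *v (x - xs)) \<bullet> y"
      unfolding Bxs using inner_matrix_vector[of y A "x - xs"] by (simp only: inner_commute)
    also have "\<dots> = 0" by (simp add: matrix_vector_mult_diff_distrib that Axs)
    finally have 1: "(x - xs) \<bullet> (B *v xs) = 0" .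
    moreover have "xs \<bullet> (B *v (x - xs)) = 0"
      using B inner_symmetric_matrix[of B xs "x - xs"] 1 by (simp add: pos_def_def inner_commute)
    ultimately show ?thesis
      by (simp add: mnorm_sq_def matrix_vector_mult_diff_distrib inner_diff_left inner_diff_right)
  qed
  have "min_norm_solution A b B = xs"
    unfolding min_norm_solution_def
  proof (rule arg_minI)
    show "A *v xs = b" by (rule Axs)
    show "\<not> 1 / 2 * mnorm_sq B x < 1 / 2 * mnorm_sq B xs" if "A *v x = b" for x
      using pyth[OF that] mnorm_sq_nonneg[OF pos_def_imp_pos_semidef[OF B], of "x - xs"] by simp
    show "x = xs" if "A *v x = b" "\<forall>y. A *v y = b \<longrightarrow> \<not> 1 / 2 * mnorm_sq B y < 1 / 2 * mnorm_sq B x" for x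
    proof (rule ccontr)
      assume "x \<noteq> xs"
      then have "0 < mnorm_sq B (x - xs)" by (intro mnorm_sq_pos B) simp
      then show False using pyth[OF that(1)] that(2) Axs by auto
    qed
  qed
  then show "A *v min_norm_solution A b B = b"
    "min_norm_solution A b B \<in> mrange (matrix_inv B ** transpose A)"
    using Axs by (auto simp: xs_def mrange_def)
qed

section \<open>Conditioning on a finitely valued random variable\<close>

lemma (in prob_space) integrable_simple_function_real:
  fixes f :: "'a \<Rightarrow> real"
  assumes "simple_function M f"
  shows "integrable M f"
  using assms by (intro integrable_simple_function) auto

text \<open>The tower property in elementary form. Conditioning on the events \<open>X = y\<close> suffices because \<open>X\<close> has finitely
  many values; on null events the weights \<open>w y\<close> are arbitrary but do not
  contribute. With finitely many sketches every iterate is such a random variable.\<close>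

lemma (in prob_space) expectation_conditional_finite:
  fixes X :: "'a \<Rightarrow> 'b" and I :: "'a \<Rightarrow> 'q::finite" and F :: "'b \<Rightarrow> 'q \<Rightarrow> real"
  assumes X: "simple_function M X" and I: "I \<in> measurable M (count_space UNIV)"
    and cond: "\<And>y i. \<P>(\<omega> in M. X \<omega> = y) > 0 \<Longrightarrow> \<P>(\<omega> in M. I \<omega> = i \<bar> X \<omega> = y) = w y i"
  shows "expectation (\<lambda>\<omega>. F (X \<omega>) (I \<omega>)) = expectation (\<lambda>\<omega>. \<Sum>i\<in>UNIV. w (X \<omega>) i * F (X \<omega>) i)"
proof -
  define U where "U = X ` space M"
  define C where "C = (\<lambda>y. {\<omega> \<in> space M. X \<omega> = y})"
  define D where "D = (\<lambda>y i. {\<omega> \<in> space M. I \<omega> = i \<and> X \<omega> = y})"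
  have finU: "finite U" using X by (simp add: U_def simple_function_def)
  have C: "C y \<in> events" for y
  proof -
    have "C y = X -` {y} \<inter> space M" by (auto simp: C_def)
    then show ?thesis using simple_functionD(2)[OF X] by simp
  qed
  have D: "D y i \<in> events" for y i
  proof -
    have "D y i = C y \<inter> (I -` {i} \<inter> space M)" by (auto simp: C_def D_def)
    then show ?thesis using C measurable_sets[OF I, of "{i}"] by auto
  qed
  have prob: "prob (D y i) = w y i * prob (C y)" if "y \<in> U" for y i
  proof (cases "prob (C y) = 0")
    case True
    moreover have "prob (D y i) \<le> prob (C y)"
      by (intro finite_measure_mono C) (auto simp: C_def D_def)
    ultimately show ?thesis using measure_nonneg[of M "D y i"] by auto
  next
    case False
    then have "prob (C y) > 0" using measure_nonneg[of M "C y"] by linarith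
    then show ?thesis using cond[of y i] False
      by (simp add: cond_prob_def C_def D_def field_simps)
  qed
  have "expectation (\<lambda>\<omega>. F (X \<omega>) (I \<omega>)) = expectation (\<lambda>\<omega>. \<Sum>y\<in>U. \<Sum>i\<in>UNIV. F y i * indicator (D y i) \<omega>)"
  proof (intro Bochner_Integration.integral_cong refl)
    fix \<omega> assume \<omega>: "\<omega> \<in> space M"
    have "(\<Sum>y\<in>U. \<Sum>i\<in>UNIV. F y i * indicator (D y i) \<omega>)
        = (\<Sum>y\<in>U. \<Sum>i\<in>UNIV. if i = I \<omega> then if y = X \<omega> then F y i else 0 else 0)"
      using \<omega> by (intro sum.cong refl) (auto simp: D_def indicator_def)
    also have "\<dots> = F (X \<omega>) (I \<omega>)" using finU \<omega> by (simp add: U_def)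
    finally show "F (X \<omega>) (I \<omega>) = (\<Sum>y\<in>U. \<Sum>i\<in>UNIV. F y i * indicator (D y i) \<omega>)" by simp
  qed
  also have "\<dots> = (\<Sum>y\<in>U. \<Sum>i\<in>UNIV. expectation (\<lambda>\<omega>. F y i * indicator (D y i) \<omega>))"
  proof -
    have "integrable M (\<lambda>\<omega>. F y i * indicator (D y i) \<omega>)" for y i
      using D by (simp add: less_top[symmetric])
    then show ?thesis
      by (simp only: Bochner_Integration.integral_sum Bochner_Integration.integrable_sum)
  qed
  also have "\<dots> = (\<Sum>y\<in>U. \<Sum>i\<in>UNIV. F y i * prob (D y i))"
    using D by simp
  also have "\<dots> = (\<Sum>y\<in>U. (\<Sum>i\<in>UNIV. w y i * F y i) * prob (C y))"
    by (intro sum.cong refl) (simp add: prob sum_distrib_left sum_distrib_right mult_ac)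
  also have "\<dots> = expectation (\<lambda>\<omega>. \<Sum>y\<in>U. (\<Sum>i\<in>UNIV. w y i * F y i) * indicator (C y) \<omega>)"
    using C by (subst Bochner_Integration.integral_sum) (auto intro!: sum.cong simp: less_top[symmetric])
  also have "\<dots> = expectation (\<lambda>\<omega>. \<Sum>i\<in>UNIV. w (X \<omega>) i * F (X \<omega>) i)"
  proof (intro Bochner_Integration.integral_cong refl)
    fix \<omega> assume \<omega>: "\<omega> \<in> space M"
    have "(\<Sum>y\<in>U. (\<Sum>i\<in>UNIV. w y i * F y i) * indicator (C y) \<omega>)
        = (\<Sum>y\<in>U. if y = X \<omega> then \<Sum>i\<in>UNIV. w y i * F y i else 0)"
      using \<omega> by (intro sum.cong refl) (auto simp: C_def indicator_def)
    also have "\<dots> = (\<Sum>i\<in>UNIV. w (X \<omega>) i * F (X \<omega>) i)" using finU \<omega> by (simp add: U_def)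
    finally show "(\<Sum>y\<in>U. (\<Sum>i\<in>UNIV. w y i * F y i) * indicator (C y) \<omega>) = (\<Sum>i\<in>UNIV. w (X \<omega>) i * F (X \<omega>) i)" .
  qed
  finally show ?thesis .
qed

section \<open>Contraction of capped adaptive sampling\<close>

lemma le_mean_on_support:
  fixes f :: "'q::finite \<Rightarrow> real"
  assumes p: "p \<in> prob_simplex" and supp: "\<And>i. p $ i \<noteq> 0 \<Longrightarrow> c \<le> f i"
  shows "c \<le> mean p f"
proof -
  have "c = (\<Sum>i\<in>UNIV. p $ i * c)" using p by (simp add: prob_simplex_def flip: sum_distrib_right)
  also have "\<dots> \<le> mean p f"
    unfolding mean_def real_scaleR_def
  proof (rule sum_mono)
    fix i
    show "p $ i * c \<le> p $ i * f i"
      using p supp[of i] by (cases "p $ i = 0") (auto simp: prob_simplex_def intro: mult_left_mono)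
  qed
  finally show ?thesis .
qed

text \<open>The capping threshold is the \<open>\<theta>\<close>-mixture of the largest loss and the reference mean loss, and each of
  the two dominates its spectral constant times the squared error.\<close>

lemma capped_mean_loss_ge:
  fixes A :: "real^'n^'m" and S :: "'q::finite \<Rightarrow> real^'t^'m"
  assumes A: "A \<noteq> 0" and B: "pos_def B" and p: "p \<in> prob_simplex" and \<theta>: "0 \<le> \<theta>" "\<theta> \<le> 1"
    and xs: "A *v xs = b" and range: "x - xs \<in> mrange (matrix_inv B ** transpose A)"
    and r: "r \<in> prob_simplex" "{i. r $ i \<noteq> 0} \<subseteq> capped_set A b B S p \<theta> x"
  shows "(\<theta> * sigma_max_sq A B S + (1 - \<theta>) * sigma_mean_sq A B S p) * mnorm_sq B (x - xs)
       \<le> mean r (\<lambda>i. sketch_loss A b B S i x)"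
proof -
  have "(\<theta> * sigma_max_sq A B S + (1 - \<theta>) * sigma_mean_sq A B S p) * mnorm_sq B (x - xs)
      = \<theta> * (sigma_max_sq A B S * mnorm_sq B (x - xs))
        + (1 - \<theta>) * (sigma_mean_sq A B S p * mnorm_sq B (x - xs))"
    by (simp add: algebra_simps)
  also have "\<dots> \<le> \<theta> * (MAX i. sketch_loss A b B S i x) + (1 - \<theta>) * mean p (\<lambda>i. sketch_loss A b B S i x)"
    unfolding sketch_loss_eq[OF xs]
    using \<theta> sigma_max_sq(1)[OF A B range] sigma_mean_sq(1)[OF A B p range]
    by (intro add_mono mult_left_mono) auto
  also have "\<dots> \<le> mean r (\<lambda>i. sketch_loss A b B S i x)"
    using r by (intro le_mean_on_support) (auto simp: capped_set_def)
  finally show ?thesis .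
qed

theorem theorem12:
  fixes A :: "real^'n^'m" and b :: "real^'m" and B :: "real^'n^'n"
    and S :: "'q::finite \<Rightarrow> real^'t^'m"
    and p :: "real^'q" and \<theta> :: real and x0 :: "real^'n"
    and M :: "'w measure"
    and x :: "nat \<Rightarrow> 'w \<Rightarrow> real^'n"
    and idx :: "nat \<Rightarrow> 'w \<Rightarrow> 'q"
    and \<pi> :: "nat \<Rightarrow> real^'n \<Rightarrow> real^'q"
  assumes "A \<noteq> 0"
    and "\<exists>z. A *v z = b"
    and "pos_def B"
    and "p \<in> prob_simplex"
    and "0 \<le> \<theta>" and "\<theta> \<le> 1"
    and "x0 \<in> mrange (matrix_inv B ** transpose A)"
    and "prob_space M"
    and "\<And>k. idx k \<in> measurable M (count_space UNIV)"
    and "\<And>\<omega>. \<omega> \<in> space M \<Longrightarrow> x 0 \<omega> = x0"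
    and "\<And>k \<omega>. \<omega> \<in> space M \<Longrightarrow> x (Suc k) \<omega> = sketch_step A b B S (idx k \<omega>) (x k \<omega>)"
    and "\<And>k \<omega>. \<omega> \<in> space M \<Longrightarrow> \<pi> k (x k \<omega>) \<in> prob_simplex"
    and "\<And>k \<omega>. \<omega> \<in> space M \<Longrightarrow>
           {i. \<pi> k (x k \<omega>) $ i \<noteq> 0} \<subseteq> capped_set A b B S p \<theta> (x k \<omega>)"
    and "\<And>k y i. \<P>(\<omega> in M. x k \<omega> = y) > 0 \<Longrightarrow>
           \<P>(\<omega> in M. idx k \<omega> = i \<bar> x k \<omega> = y) = \<pi> k y $ i"
  shows "\<forall>k. prob_space.expectation M (\<lambda>\<omega>. mnorm_sq B (x k \<omega> - min_norm_solution A b B))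
           \<le> (1 - \<theta> * sigma_max_sq A B S - (1 - \<theta>) * sigma_mean_sq A B S p) ^ k
              * mnorm_sq B (x0 - min_norm_solution A b B)"
proof -
  interpret prob_space M by fact
  note A = assms(1) and B = assms(3) and p = assms(4) and \<theta> = assms(5,6)
    and x0 = assms(7) and idx = assms(9) and init = assms(10) and step = assms(11)
    and simplex = assms(12) and supp = assms(13) and cond = assms(14)
  let ?V = "mrange (matrix_inv B ** transpose A)"
  define xs where "xs = min_norm_solution A b B"
  obtain z where z: "A *v z = b" using assms(2) by blast
  have xs: "A *v xs = b" "xs \<in> ?V"
    using min_norm_solution[OF B z] by (simp_all add: xs_def)
  define c where "c = \<theta> * sigma_max_sq A B S + (1 - \<theta>) * sigma_mean_sq A B S p"
  have "c \<le> \<theta> * 1 + (1 - \<theta>) * 1"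
    unfolding c_def using \<theta> sigma_max_sq(2)[OF A B] sigma_mean_sq(2)[OF A B p]
    by (intro add_mono mult_left_mono) auto
  then have c: "0 \<le> 1 - c" by simp
  have simple: "simple_function M (x k)" for k
  proof (induction k)
    case 0
    show ?case using simple_function_cong[of M "x 0" "\<lambda>_. x0"] init by simp
  next
    case (Suc k)
    have "simple_function M (idx k)" using idx by (simp add: simple_function_eq_measurable)
    then have "simple_function M (\<lambda>\<omega>. sketch_step A b B S (idx k \<omega>) (x k \<omega>))"
      using Suc by (rule simple_function_compose2)
    also have "?this \<longleftrightarrow> simple_function M (x (Suc k))"
      by (intro simple_function_cong) (simp add: step)
    finally show ?case .
  qed
  \<comment> \<open>The spectral bounds apply only inside the range, so the errors must never leave it.\<close>
  have range: "x k \<omega> - xs \<in> ?V" if "\<omega> \<in> space M" for k \<omega>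
  proof (induction k)
    case 0
    show ?case using init[OF that] x0 xs(2) by (simp add: subspace_diff[OF subspace_mrange])
  next
    case (Suc k)
    have "x (Suc k) \<omega> - xs = (x k \<omega> - xs)
        - (matrix_inv B ** transpose A) *v (sketch_H A B S (idx k \<omega>) *v (A *v (x k \<omega> - xs)))"
      by (simp only: step[OF that] sketch_step_error[OF xs(1)] matrix_vector_mul_assoc matrix_mul_assoc)
    also have "\<dots> \<in> ?V"
      by (rule subspace_diff[OF subspace_mrange Suc]) (simp add: mrange_def)
    finally show ?case .
  qed
  have int: "integrable M (\<lambda>\<omega>. f (x k \<omega>))" for k and f :: "real^'n \<Rightarrow> real"
    using simple_function_compose1[OF simple] by (rule integrable_simple_function_real)
  have contraction: "expectation (\<lambda>\<omega>. mnorm_sq B (x (Suc k) \<omega> - xs))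
      \<le> (1 - c) * expectation (\<lambda>\<omega>. mnorm_sq B (x k \<omega> - xs))" for k
  proof -
    have "expectation (\<lambda>\<omega>. mnorm_sq B (x (Suc k) \<omega> - xs))
        = expectation (\<lambda>\<omega>. (\<lambda>y i. mnorm_sq B (y - xs) - sketch_loss A b B S i y) (x k \<omega>) (idx k \<omega>))"
      by (intro Bochner_Integration.integral_cong refl)
        (simp add: step mnorm_sq_sketch_step[OF B xs(1)])
    also have "\<dots> = expectation (\<lambda>\<omega>. \<Sum>i\<in>UNIV. \<pi> k (x k \<omega>) $ i
                       * (mnorm_sq B (x k \<omega> - xs) - sketch_loss A b B S i (x k \<omega>)))"
      by (rule expectation_conditional_finite[OF simple idx cond])
    also have "\<dots> \<le> expectation (\<lambda>\<omega>. (1 - c) * mnorm_sq B (x k \<omega> - xs))"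
    proof (rule integral_mono)
      show "integrable M (\<lambda>\<omega>. \<Sum>i\<in>UNIV. \<pi> k (x k \<omega>) $ i
              * (mnorm_sq B (x k \<omega> - xs) - sketch_loss A b B S i (x k \<omega>)))"
        by (rule int)
      show "integrable M (\<lambda>\<omega>. (1 - c) * mnorm_sq B (x k \<omega> - xs))" by (rule int)
      fix \<omega> assume \<omega>: "\<omega> \<in> space M"
      have "(\<Sum>i\<in>UNIV. \<pi> k (x k \<omega>) $ i * (mnorm_sq B (x k \<omega> - xs) - sketch_loss A b B S i (x k \<omega>)))
          = (\<Sum>i\<in>UNIV. \<pi> k (x k \<omega>) $ i) * mnorm_sq B (x k \<omega> - xs)
            - mean (\<pi> k (x k \<omega>)) (\<lambda>i. sketch_loss A b B S i (x k \<omega>))"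
        by (simp add: mean_def right_diff_distrib sum_subtractf sum_distrib_right)
      also have "\<dots> \<le> (1 - c) * mnorm_sq B (x k \<omega> - xs)"
        using capped_mean_loss_ge[OF A B p \<theta> xs(1) range[OF \<omega>] simplex[OF \<omega>] supp[OF \<omega>]]
          simplex[OF \<omega>, of k] by (simp add: c_def prob_simplex_def algebra_simps)
      finally show "(\<Sum>i\<in>UNIV. \<pi> k (x k \<omega>) $ i
          * (mnorm_sq B (x k \<omega> - xs) - sketch_loss A b B S i (x k \<omega>))) \<le> (1 - c) * mnorm_sq B (x k \<omega> - xs)" .
    qed
    finally show ?thesis by simp
  qed
  have "expectation (\<lambda>\<omega>. mnorm_sq B (x k \<omega> - xs)) \<le> (1 - c) ^ k * mnorm_sq B (x0 - xs)" for k
  proof (induction k)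
    case 0
    have "expectation (\<lambda>\<omega>. mnorm_sq B (x 0 \<omega> - xs)) = expectation (\<lambda>\<omega>. mnorm_sq B (x0 - xs))"
      by (intro Bochner_Integration.integral_cong refl) (simp add: init)
    then show ?case by (simp add: prob_space)
  next
    case (Suc k)
    have "(1 - c) * expectation (\<lambda>\<omega>. mnorm_sq B (x k \<omega> - xs)) \<le> (1 - c) * ((1 - c) ^ k * mnorm_sq B (x0 - xs))"
      using Suc c by (rule mult_left_mono)
    then show ?case using contraction[of k] by (simp add: mult.assoc)
  qed
  then show ?thesis by (simp add: c_def xs_def diff_diff_eq)
qed

end
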